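(* For every integer $n\geq 4$, the path $P_n$ on $n$ vertices satisfies $\chi_{td}(P_n)=4$.
   Context: Graphs are finite, simple and undirected. A total labeling of a graph $G$ is a function $f:V(G)\cup E(G)\to\mathbb{Z}^+$ (positive integers) such that $f(u)\neq f(v)$ for adjacent vertices $u,v$; $f(\{u,v\})\neq f(\{v,w\})$ for any two distinct incident edges $\{u,v\},\{v,w\}$; and $f(u)\neq f(\{u,v\})$ for every edge $\{u,v\}$ and incident vertex $u$. It is a $k$-total labeling if the maximum label assigned to any vertex or edge is $k$. A $k$-total difference labeling is a $k$-total labeling $f$ with $f(\{u,v\})=|f(u)-f(v)|$ for every edge $\{u,v\}$. The total difference chromatic number $\chi_{td}(G)$ is the smallest integer $k$ for which $G$ has a $k$-total difference labeling. *)

theory Defs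
  imports Main
begin

text \<open>Undirected graphs are pairs of a vertex set and a set of edges, each edge being the
  two-element set of its endpoints. The definitions below are meant for arguments
  satisfying \<open>fin_sgraph\<close>.\<close>

type_synonym 'a ugraph = "'a set \<times> 'a set set"

abbreviation verts :: "'a ugraph \<Rightarrow> 'a set" where
  "verts G \<equiv> fst G"

abbreviation edges :: "'a ugraph \<Rightarrow> 'a set set" where
  "edges G \<equiv> snd G"

definition fin_sgraph :: "'a ugraph \<Rightarrow> bool" where
  "fin_sgraph G \<longleftrightarrow> finite (verts G) \<and> (\<forall>e\<in>edges G. e \<subseteq> verts G \<and> card e = 2)"

definition path_graph :: "nat \<Rightarrow> nat ugraph" where
  "path_graph n = ({..<n}, {{i, Suc i} | i. Suc i < n})"

lemma fin_sgraph_path_graph: "fin_sgraph (path_graph n)"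
  by (auto simp: fin_sgraph_def path_graph_def)

text \<open>A labeling is defined on the disjoint union of vertices (\<open>Inl\<close>) and edges (\<open>Inr\<close>);
  its values outside \<open>verts G <+> edges G\<close> are irrelevant. The edges \<open>{u, v}\<close> and \<open>{v, w}\<close>
  of a simple graph are distinct iff \<open>u \<noteq> w\<close>.\<close>

definition total_labeling :: "'a ugraph \<Rightarrow> ('a + 'a set \<Rightarrow> nat) \<Rightarrow> bool" where
  "total_labeling G f \<longleftrightarrow>
     (\<forall>x \<in> verts G <+> edges G. 0 < f x) \<and>
     (\<forall>u v. {u, v} \<in> edges G \<longrightarrow> f (Inl u) \<noteq> f (Inl v)) \<and>
     (\<forall>u v w. {u, v} \<in> edges G \<and> {v, w} \<in> edges G \<and> {u, v} \<noteq> {v, w} \<longrightarrow>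
        f (Inr {u, v}) \<noteq> f (Inr {v, w})) \<and>
     (\<forall>u v. {u, v} \<in> edges G \<longrightarrow> f (Inl u) \<noteq> f (Inr {u, v}))"

definition k_total_labeling :: "nat \<Rightarrow> 'a ugraph \<Rightarrow> ('a + 'a set \<Rightarrow> nat) \<Rightarrow> bool" where
  "k_total_labeling k G f \<longleftrightarrow> total_labeling G f \<and> Max (f ` (verts G <+> edges G)) = k"

definition k_total_difference_labeling ::
    "nat \<Rightarrow> 'a ugraph \<Rightarrow> ('a + 'a set \<Rightarrow> nat) \<Rightarrow> bool" where
  "k_total_difference_labeling k G f \<longleftrightarrow>
     k_total_labeling k G f \<and>
     (\<forall>u v. {u, v} \<in> edges G \<longrightarrow>
        int (f (Inr {u, v})) = \<bar>int (f (Inl u)) - int (f (Inl v))\<bar>)"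

text \<open>Every nonempty finite simple graph has a total difference labeling for some \<open>k\<close>
  (label the vertices by distinct powers of 3), so the minimum is attained.\<close>

definition total_difference_chromatic_number :: "'a ugraph \<Rightarrow> nat" where
  "total_difference_chromatic_number G = (LEAST k. \<exists>f. k_total_difference_labeling k G f)"

end

theory Submission
  imports Defs
begin

text \<open>If all labels are at most 3, two adjacent vertices can only carry the labels 1, 3 or 2, 3,
  since an edge between 1 and 2 would be labeled 1. One of the two inner vertices of
  \<open>P\<^sub>4\<close> is therefore not labeled 3, both its neighbours are labeled 3, and its two
  edges get equal labels. With 4 allowed, the periodic vertex labels \<open>1, 4, 3, 1, 4, 3, \<dots>\<close> induce the
  periodic edge labels \<open>3, 1, 2, 3, 1, 2, \<dots>\<close>.\<close>

lemma edges_path_graph_iff: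
  "{u, v} \<in> edges (path_graph n) \<longleftrightarrow> v = Suc u \<and> v < n \<or> u = Suc v \<and> u < n"
  by (auto simp: path_graph_def doubleton_eq_iff)

text \<open>\<open>Max\<close> bounds the members of finite sets only, so the label set must be
  shown finite; the edges lie in the power set of the vertices.\<close>

lemma k_total_labeling_label_le:
  assumes "fin_sgraph G" "k_total_labeling k G f" "x \<in> verts G <+> edges G"
  shows "f x \<le> k"
proof -
  have "finite (edges G)"
    using assms(1) by (auto simp: fin_sgraph_def intro: finite_subset[of _ "Pow (verts G)"])
  then have "finite (f ` (verts G <+> edges G))"
    using assms(1) by (simp add: fin_sgraph_def)
  then show ?thesis
    using assms(2,3) unfolding k_total_labeling_def by (metis Max_ge imageI)
qed

lemma path_graph_label_ge_4:
  assumes "n \<ge> 4" and f: "k_total_difference_labeling k (path_graph n) f"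
  shows "k \<ge> 4"
proof (rule ccontr)
  assume "\<not> k \<ge> 4"
  have kt: "k_total_labeling k (path_graph n) f"
    using f by (simp add: k_total_difference_labeling_def)
  have vertex: "0 < f (Inl i) \<and> f (Inl i) \<le> 3" if "i < 4" for i
  proof -
    have "Inl i \<in> verts (path_graph n) <+> edges (path_graph n)"
      using that assms(1) by (auto simp: path_graph_def)
    then have "0 < f (Inl i)" "f (Inl i) \<le> k"
      using kt k_total_labeling_label_le[OF fin_sgraph_path_graph kt]
      unfolding k_total_labeling_def total_labeling_def by blast+
    then show ?thesis
      using \<open>\<not> k \<ge> 4\<close> by simp
  qed
  have edge: "{i, Suc i} \<in> edges (path_graph n)" if "i < 3" for i
    using that assms(1) by (auto simp: edges_path_graph_iff)
  have adjacent: "f (Inl i) \<noteq> f (Inl (Suc i)) \<and> f (Inl i) \<noteq> f (Inr {i, Suc i}) \<and>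
      f (Inl (Suc i)) \<noteq> f (Inr {i, Suc i}) \<and>
      int (f (Inr {i, Suc i})) = \<bar>int (f (Inl i)) - int (f (Inl (Suc i)))\<bar>"
    if "i < 3" for i
  proof -
    \<comment> \<open>Each instance of the vertex-edge condition in \<open>total_labeling\<close>
      concerns the endpoint named first, so \<open>Suc i\<close> is covered by the reversed
      edge.\<close>
    have "{Suc i, i} \<in> edges (path_graph n)"
      using edge[OF that] by (simp add: insert_commute)
    then have "f (Inl (Suc i)) \<noteq> f (Inr {Suc i, i})"
      using kt unfolding k_total_labeling_def total_labeling_def by blast
    then have "f (Inl (Suc i)) \<noteq> f (Inr {i, Suc i})"
      by (simp add: insert_commute)
    then show ?thesis
      using f edge[OF that]
      unfolding k_total_difference_labeling_def k_total_labeling_def total_labeling_def by blast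
  qed
  have incident: "f (Inr {i, Suc i}) \<noteq> f (Inr {Suc i, Suc (Suc i)})" if "i < 2" for i
  proof -
    have "{i, Suc i} \<noteq> {Suc i, Suc (Suc i)}"
      by (auto simp: doubleton_eq_iff)
    then show ?thesis
      using kt edge[of i] edge[of "Suc i"] that
      by (simp add: k_total_labeling_def total_labeling_def)
  qed
  have three: "f (Inl i) = 3 \<longleftrightarrow> f (Inl (Suc i)) \<noteq> 3" if "i < 3" for i
  proof -
    have "f (Inl i) \<in> {1, 2, 3}" "f (Inl (Suc i)) \<in> {1, 2, 3}"
      using vertex[of i] vertex[of "Suc i"] that by auto
    then show ?thesis
      using adjacent[OF that] by auto
  qed
  \<comment> \<open>\<open>Suc i\<close> ranges over the inner vertices 1 and 2. Otherwise both of
    its edges would be labeled \<open>3 - f (Inl (Suc i))\<close>.\<close>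
  have alternate: "f (Inl (Suc i)) = 3" if "i < 2" for i
  proof (rule ccontr)
    assume "f (Inl (Suc i)) \<noteq> 3"
    then have "f (Inl i) = 3" "f (Inl (Suc (Suc i))) = 3"
      using three[of i] three[of "Suc i"] that by auto
    then have "int (f (Inr {i, Suc i})) = int (f (Inr {Suc i, Suc (Suc i)}))"
      using adjacent[of i] adjacent[of "Suc i"] that by (simp add: abs_minus_commute)
    then show False
      using incident[OF that] by simp
  qed
  show False
    \<comment> \<open>Vertices 1 and 2 are adjacent, so \<open>three\<close> forbids that both are
      labeled 3.\<close>
    using alternate[of 0] alternate[of 1] three[of 1] by simp
qed

text \<open>\<open>Min e\<close> recovers \<open>i\<close> from the edge \<open>{i, Suc i}\<close>,
  so one residue mod 3 fixes the edge label. Every other set also gets a value from 1 to 3, which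
  lets the bounds hold for all arguments.\<close>

definition path_labeling :: "nat + nat set \<Rightarrow> nat" where
  "path_labeling x = (case x of
     Inl i \<Rightarrow> if i mod 3 = 0 then 1 else if i mod 3 = 1 then 4 else 3
   | Inr e \<Rightarrow> if Min e mod 3 = 0 then 3 else if Min e mod 3 = 1 then 1 else 2)"

lemma path_labeling_edge:
  "path_labeling (Inr {i, Suc i}) = (if i mod 3 = 0 then 3 else if i mod 3 = 1 then 1 else 2)"
  "path_labeling (Inr {Suc i, i}) = (if i mod 3 = 0 then 3 else if i mod 3 = 1 then 1 else 2)"
  by (simp_all add: path_labeling_def)

lemma k_total_difference_labeling_path_labeling:
  assumes "n \<ge> 2"
  shows "k_total_difference_labeling 4 (path_graph n) path_labeling"
proof -
  let ?X = "verts (path_graph n) <+> edges (path_graph n)"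
  have bounds: "0 < path_labeling x" "path_labeling x \<le> 4" for x
    by (auto simp: path_labeling_def split: sum.split)
  have "finite (path_labeling ` ?X)"
    by (rule finite_subset[of _ "{..4}"]) (use bounds in auto)
  \<comment> \<open>Vertex 1 carries the label 4; it exists since \<open>n \<ge> 2\<close>.\<close>
  moreover have "4 \<in> path_labeling ` ?X"
    by (rule image_eqI[of _ _ "Inl 1"])
      (use assms in \<open>auto simp: path_labeling_def path_graph_def\<close>)
  ultimately have max: "Max (path_labeling ` ?X) = 4"
    using bounds by (intro Max_eqI) auto
  have edge: "path_labeling (Inl u) \<noteq> path_labeling (Inl v) \<and>
      path_labeling (Inl u) \<noteq> path_labeling (Inr {u, v}) \<and>
      int (path_labeling (Inr {u, v})) =
        \<bar>int (path_labeling (Inl u)) - int (path_labeling (Inl v))\<bar>"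
    if "{u, v} \<in> edges (path_graph n)" for u v
    using that unfolding edges_path_graph_iff
    \<comment> \<open>\<open>mod_Suc\<close> reduces all labels to the residue of the smaller
      endpoint; the three cases are |1 - 4| = 3, |4 - 3| = 1 and |3 - 1| = 2.\<close>
    by (elim disjE conjE; simp only: path_labeling_edge; simp add: path_labeling_def mod_Suc; arith)
  have incident: "path_labeling (Inr {u, v}) \<noteq> path_labeling (Inr {v, w})"
    if "{u, v} \<in> edges (path_graph n)" "{v, w} \<in> edges (path_graph n)" "{u, v} \<noteq> {v, w}"
    for u v w
  proof -
    have "u \<noteq> w"
      using that(3) by (auto simp: insert_commute)
    \<comment> \<open>The three vertices are consecutive, rising or falling, so the smaller
      endpoints of the two edges have different residues mod 3.\<close>
    then have "v = Suc u \<and> w = Suc v \<or> u = Suc v \<and> v = Suc w"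
      using that(1,2) unfolding edges_path_graph_iff by linarith
    then show ?thesis
      by (elim disjE conjE; simp add: path_labeling_edge mod_Suc; arith)
  qed
  show ?thesis
    unfolding k_total_difference_labeling_def k_total_labeling_def total_labeling_def
    using bounds max edge incident by blast
qed

theorem theorem3p1:
  fixes n :: nat
  assumes "n \<ge> 4"
  shows "total_difference_chromatic_number (path_graph n) = 4"
  unfolding total_difference_chromatic_number_def
  using assms k_total_difference_labeling_path_labeling[of n] path_graph_label_ge_4
  by (intro Least_equality) auto

end
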